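(* Let $f\in\mathbb{Z}[t_1^{\pm1},\dots,t_n^{\pm1}]$ be a nonzero Laurent polynomial whose Newton polyhedron $N(f)$ has dimension $m$, and fix a coordinate system with $m$ essential variables for $f$. In this coordinate system the Laurent norm unit ball $\mathcal{B}_f=\{\phi\in(\mathbb{R}^n)^*\mid\|\phi\|_f\le1\}$ and the reduced Laurent norm unit ball $\tilde{\mathcal{B}}_f=\{\phi\in(\mathbb{R}^m)^*\mid\|\phi\|_f\le1\}$ are related by $$\mathcal{B}_f=\tilde{\mathcal{B}}_f\times(\mathbb{R}^{n-m})^*.$$
   Context: For nonzero $f=\sum c_\alpha\mathbf{t}^\alpha\in\mathbb{Z}[t_1^{\pm1},\dots,t_n^{\pm1}]$, let $\operatorname{supp}(f)=\{\alpha\in\mathbb{Z}^n:c_\alpha\ne0\}$; the Newton polyhedron $N(f)$ is the convex hull of $\operatorname{supp}(f)$ in $\mathbb{R}^n$, and $m=\dim N(f)\le n$ is its (affine) dimension. The Laurent norm of $\phi\in(\mathbb{R}^n)^*$ is $\|\phi\|_f=\sup_{\alpha,\beta\in\operatorname{supp}(f)}\phi(\alpha-\beta)$. Essential variables: choose an affine coordinate system $(x_1,\dots,x_n)$ of $\mathbb{R}^n$ (i.e. an affine bijection $A:\mathbb{R}^n\to\mathbb{R}^n$) in which the last $n-m$ coordinates vanish identically on $N(f)$, i.e. $A(N(f))\subset\mathbb{R}^m\times\{0\}$. The set $\operatorname{supp}(f)$ and the polyhedron $N(f)$ are then expressed in these coordinates (replaced by their images under $A$), dual vectors are written $\phi=(\phi_1,\dots,\phi_n)$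 with $\phi(x)=\sum_i\phi_ix_i$, and $\|\phi\|_f$ is given by the same formula using the exponents in these coordinates. The coordinates $(x_1,\dots,x_m)$, and dually $(\phi_1,\dots,\phi_m)$, are the essential variables. $(\mathbb{R}^m)^*$ is the subspace of dual vectors with $\phi_{m+1}=\dots=\phi_n=0$, $(\mathbb{R}^{n-m})^*$ is the subspace with $\phi_1=\dots=\phi_m=0$, and $(\mathbb{R}^n)^*$ is identified with $(\mathbb{R}^m)^*\times(\mathbb{R}^{n-m})^*$. *)

theory Defs
  imports "HOL-Analysis.Analysis" "HOL-Library.Poly_Mapping"
begin

section \<open>Laurent polynomials and Newton polyhedra\<close>

text \<open>
  A Laurent polynomial over the integers in \<open>n = CARD('n)\<close> variables is an element of the
  group ring of \<open>\<int>\<^sup>n\<close>: a finitely supported function from exponent vectors to coefficients,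
  multiplied by convolution.
\<close>

type_synonym 'n laurent_poly = "(int ^ 'n) \<Rightarrow>\<^sub>0 int"

definition supp :: "'n::finite laurent_poly \<Rightarrow> (real ^ 'n) set" where
  "supp f = (\<lambda>\<alpha>. \<chi> i. of_int (\<alpha> $ i)) ` Poly_Mapping.keys f"

definition newton_polyhedron :: "'n::finite laurent_poly \<Rightarrow> (real ^ 'n) set" where
  "newton_polyhedron f = convex hull (supp f)"


section \<open>Coordinate systems with essential variables\<close>

text \<open>
  The index type \<^typ>\<open>'n\<close> is linearly ordered, so that the first \<open>m\<close> and the last \<open>n - m\<close>
  coordinates make sense: \<open>coord_number i\<close> is the position of \<open>i\<close> in \<open>1, \<dots>, n\<close>.
\<close>

definition coord_number :: "'n::{finite,linorder} \<Rightarrow> nat" where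
  "coord_number i = card {..i}"

lemma coord_number_less_iff: "coord_number i < coord_number j \<longleftrightarrow> i < j"
proof -
  have *: "coord_number a < coord_number b" if "a < b" for a b :: 'a
    unfolding coord_number_def using that by (intro psubset_card_mono) auto
  show ?thesis
    using *[of i j] *[of j i] by (cases i j rule: linorder_cases) auto
qed

lemma bij_betw_coord_number:
  "bij_betw coord_number (UNIV :: 'n::{finite,linorder} set) {1..CARD('n)}"
proof -
  have inj: "inj (coord_number :: 'n \<Rightarrow> nat)"
    by (rule injI) (metis coord_number_less_iff less_irrefl neq_iff)
  have "coord_number i \<in> {1..CARD('n)}" for i :: 'n
    unfolding coord_number_def by (auto simp: Suc_le_eq card_gt_0_iff intro!: card_mono)
  then have "range (coord_number :: 'n \<Rightarrow> nat) = {1..CARD('n)}"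
    by (intro card_subset_eq) (auto simp: card_image[OF inj])
  with inj show ?thesis by (simp add: bij_betw_def)
qed

definition affine_map :: "('a::real_vector \<Rightarrow> 'b::real_vector) \<Rightarrow> bool" where
  "affine_map A \<longleftrightarrow> (\<exists>L b. linear L \<and> (\<forall>x. A x = L x + b))"

definition essential_coords ::
    "'n::{finite,linorder} laurent_poly \<Rightarrow> nat \<Rightarrow> (real ^ 'n::_ \<Rightarrow> real ^ 'n::_) \<Rightarrow> bool" where
  "essential_coords f m A \<longleftrightarrow>
     affine_map A \<and> bij A \<and>
     (\<forall>x \<in> A ` newton_polyhedron f. \<forall>i. m < coord_number i \<longrightarrow> x $ i = 0)"


section \<open>The Laurent norm and its unit balls\<close>

text \<open>
  A dual vector \<open>\<phi>\<close> is given by its components and acts by \<open>\<phi>(x) = \<phi> \<bullet> x\<close>, the sum of the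
  products \<open>\<phi>\<^sub>i x\<^sub>i\<close>. All exponents are expressed in the coordinate system \<open>A\<close>; for \<open>A = id\<close>
  this is the norm in the original coordinates. For \<open>f \<noteq> 0\<close> the supremum is over a finite
  nonempty set.
\<close>

definition laurent_norm ::
    "(real ^ 'n::finite \<Rightarrow> real ^ 'n) \<Rightarrow> 'n laurent_poly \<Rightarrow> real ^ 'n \<Rightarrow> real" where
  "laurent_norm A f \<phi> = (SUP (\<alpha>, \<beta>) \<in> A ` supp f \<times> A ` supp f. \<phi> \<bullet> (\<alpha> - \<beta>))"

definition dual_essential :: "nat \<Rightarrow> (real ^ 'n::{finite,linorder}) set" where
  "dual_essential m = {\<phi>. \<forall>i. m < coord_number i \<longrightarrow> \<phi> $ i = 0}"

definition dual_inessential :: "nat \<Rightarrow> (real ^ 'n::{finite,linorder}) set" where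
  "dual_inessential m = {\<phi>. \<forall>i. coord_number i \<le> m \<longrightarrow> \<phi> $ i = 0}"

text \<open>The identification of the whole dual space with the product of these two subspaces:\<close>

definition dual_split ::
    "nat \<Rightarrow> real ^ 'n::{finite,linorder} \<Rightarrow> (real ^ 'n::_) \<times> (real ^ 'n::_)" where
  "dual_split m \<phi> =
     (\<chi> i. if coord_number i \<le> m then \<phi> $ i else 0,
      \<chi> i. if coord_number i \<le> m then 0 else \<phi> $ i)"

lemma bij_betw_dual_split:
  "bij_betw (dual_split m) UNIV (dual_essential m \<times> dual_inessential m)"
  by (rule bij_betw_byWitness[where f' = "\<lambda>(\<phi>, \<psi>). \<phi> + \<psi>"])
     (auto simp: dual_split_def dual_essential_def dual_inessential_def vec_eq_iff)

definition laurent_ball ::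
    "(real ^ 'n::finite \<Rightarrow> real ^ 'n) \<Rightarrow> 'n laurent_poly \<Rightarrow> (real ^ 'n) set" where
  "laurent_ball A f = {\<phi>. laurent_norm A f \<phi> \<le> 1}"

definition reduced_laurent_ball ::
    "nat \<Rightarrow> (real ^ 'n::{finite,linorder} \<Rightarrow> real ^ 'n::_) \<Rightarrow> 'n laurent_poly \<Rightarrow> (real ^ 'n::_) set"
  where "reduced_laurent_ball m A f = {\<phi> \<in> dual_essential m. laurent_norm A f \<phi> \<le> 1}"

end

theory Submission
  imports Defs
begin

text \<open>
  In essential coordinates the last \<open>n - m\<close> coordinates of every exponent vanish, so a dual
  vector pairs with an exponent only through its essential part. Hence the Laurent norm of
  \<open>\<phi>\<close> is that of its component in the essential subspace, and the other component is free.
\<close>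

text \<open>The sums agree termwise: up to position \<open>m\<close> the dual components coincide,
  beyond it \<open>x $ i\<close> is zero.\<close>

lemma inner_essential_part:
  fixes x \<phi> :: "real ^ 'n::{finite,linorder}"
  assumes "\<And>i. m < coord_number i \<Longrightarrow> x $ i = 0"
  shows "fst (dual_split m \<phi>) \<bullet> x = \<phi> \<bullet> x"
  unfolding inner_vec_def dual_split_def
  by (rule sum.cong) (auto simp: assms not_le)

lemma laurent_norm_essential_part:
  assumes "essential_coords f m A"
  shows "laurent_norm A f (fst (dual_split m \<phi>)) = laurent_norm A f \<phi>"
proof -
  \<comment> \<open>The vanishing assumed on the image of the convex hull restricts to its
    generating set.\<close>
  have "x $ i = 0" if "x \<in> A ` supp f" "m < coord_number i" for x i
    using assms that hull_subset[of "supp f" convex]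
    unfolding essential_coords_def newton_polyhedron_def by blast
  then have "fst (dual_split m \<phi>) \<bullet> x = \<phi> \<bullet> x" if "x \<in> A ` supp f" for x
    using that by (intro inner_essential_part) blast
  \<comment> \<open>Linearity extends the equality to differences of exponents.\<close>
  then show ?thesis
    unfolding laurent_norm_def
    by (intro SUP_cong refl) (auto simp: inner_diff_right)
qed

theorem theorem5p3:
  fixes f :: "'n::{finite,linorder} laurent_poly"
    and m :: nat
    and A :: "real ^ 'n::_ \<Rightarrow> real ^ 'n::_"
  assumes "f \<noteq> 0"
    and "aff_dim (newton_polyhedron f) = int m"
    and "essential_coords f m A"
  shows "dual_split m ` laurent_ball A f = reduced_laurent_ball m A f \<times> dual_inessential m"
proof -
  have "laurent_ball A f = {\<phi>. laurent_norm A f (fst (dual_split m \<phi>)) \<le> 1}"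
    unfolding laurent_ball_def laurent_norm_essential_part[OF assms(3)] ..
  \<comment> \<open>The ball condition now sees \<open>\<phi>\<close> only through
    \<open>dual_split m \<phi>\<close>, so the image is the range cut down by that
    condition.\<close>
  then have "dual_split m ` laurent_ball A f =
      {p \<in> range (dual_split m). laurent_norm A f (fst p) \<le> 1}"
    by auto
  also have "range (dual_split m) = dual_essential m \<times> dual_inessential m"
    using bij_betw_dual_split by (rule bij_betw_imp_surj_on)
  finally show ?thesis
    unfolding reduced_laurent_ball_def by auto
qed

end
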